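(* Let $t$ be a positive integer and suppose there are positive constants $c$ and $C$ such that $c n^{2 - 1/t} \leq z(n; t) \leq C n^{2 - 1/t}$ holds for all positive integers $n$. Then for every integer $k \geq \frac{2C}{3c}$ and for every $n$ that is a sufficiently large (in terms of $k$, $t$, $c$, $C$) multiple of $3k$, there is a $K_{t,t,t}$-free $n \times n \times n$ tripartite graph $G_{k,n}$ with minimum degree at least $n + (c/4) \cdot n^{1 - 1/t}$. Further, these graphs $G_{k,n}$ can be chosen such that, for all $k \neq k'$, at least $\Omega(n^2)$ edges of $G_{k,n}$ need to be deleted to obtain a subgraph of $G_{k',n}$.
   Context: All graphs are finite and simple. An $n \times n \times n$ tripartite graph is a graph whose vertex set is partitioned into three independent sets, each of size $n$. $z(n;t)$ denotes the maximum number of edges in a bipartite graph with both parts of size $n$ that does not contain $K_{t,t}$ as a subgraph. $K_{t,t,t}$ is the complete tripartite graph with $t$ vertices in each part, and a graph is $K_{t,t,t}$-free if it has no (not necessarily induced) subgraph isomorphic to $K_{t,t,t}$. "A subgraph of $G_{k',n}$" means a graph isomorphic to a subgraph of $G_{k',n}$. The final assertion means: for each pair of distinct admissible $k, k'$ there is a constant $\varepsilon > 0$ (independent of $n$) such that for all sufficiently large $n$ for which both $G_{k,n}$ and $G_{k',n}$ are defined, at least $\varepsilon n^2$ edges must be deleted from $G_{k,n}$ to obtain a graph isomorphic to a subgraph of $G_{k',n}$. *)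

theory Defs
  imports Complex_Main "HOL-Library.Disjoint_Sets"
begin

record 'a graph =
  verts :: "'a set"
  edges :: "'a set set"

definition simple_graph :: "'a graph \<Rightarrow> bool" where
  "simple_graph G \<longleftrightarrow>
     finite (verts G) \<and> (\<forall>e\<in>edges G. e \<subseteq> verts G \<and> card e = 2)"

definition subgraph :: "'a graph \<Rightarrow> 'a graph \<Rightarrow> bool" where
  "subgraph S G \<longleftrightarrow>
     simple_graph S \<and> verts S \<subseteq> verts G \<and> edges S \<subseteq> edges G"

definition isomorphic :: "'a graph \<Rightarrow> 'b graph \<Rightarrow> bool" where
  "isomorphic G H \<longleftrightarrow>
     (\<exists>f. bij_betw f (verts G) (verts H) \<and>
          (\<forall>x\<in>verts G. \<forall>y\<in>verts G. {x, y} \<in> edges G \<longleftrightarrow> {f x, f y} \<in> edges H))"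

definition embeds :: "'a graph \<Rightarrow> 'b graph \<Rightarrow> bool" where
  "embeds H G \<longleftrightarrow> (\<exists>S. subgraph S G \<and> isomorphic H S)"

definition independent :: "'a graph \<Rightarrow> 'a set \<Rightarrow> bool" where
  "independent G A \<longleftrightarrow> (\<forall>x\<in>A. \<forall>y\<in>A. {x, y} \<notin> edges G)"

text \<open>An \<open>n \<times> \<dots> \<times> n\<close> graph with \<open>r\<close> parts: bipartite for \<open>r = 2\<close>, tripartite for \<open>r = 3\<close>.\<close>

definition balanced_multipartite :: "nat \<Rightarrow> nat \<Rightarrow> 'a graph \<Rightarrow> bool" where
  "balanced_multipartite r n G \<longleftrightarrow>
     simple_graph G \<and>
     (\<exists>P :: nat \<Rightarrow> 'a set.
        disjoint_family_on P {..<r} \<and> (\<Union>i<r. P i) = verts G \<and>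
        (\<forall>i<r. card (P i) = n \<and> independent G (P i)))"

text \<open>\<open>K\<^bsub>t,\<dots>,t\<^esub>\<close> with \<open>r\<close> parts; the first component of a vertex names its part.\<close>

definition complete_multipartite :: "nat \<Rightarrow> nat \<Rightarrow> (nat \<times> nat) graph" where
  "complete_multipartite r t =
     \<lparr> verts = {..<r} \<times> {..<t},
       edges = {{x, y} |x y. x \<in> {..<r} \<times> {..<t} \<and> y \<in> {..<r} \<times> {..<t} \<and> fst x \<noteq> fst y} \<rparr>"

text \<open>The number \<open>z(n;t)\<close>. Every finite graph is isomorphic to one on natural numbers, so
  fixing the vertex type loses nothing. For \<open>t \<ge> 1\<close> the set is nonempty (take no edges), and it
  is finite, its members being at most \<open>n\<^sup>2\<close>.\<close>

definition zarankiewicz :: "nat \<Rightarrow> nat \<Rightarrow> nat" where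
  "zarankiewicz n t =
     Max {card (edges G) |G :: nat graph.
            balanced_multipartite 2 n G \<and> \<not> embeds (complete_multipartite 2 t) G}"

definition degree :: "'a graph \<Rightarrow> 'a \<Rightarrow> nat" where
  "degree G v = card {u. {v, u} \<in> edges G}"

definition min_degree :: "'a graph \<Rightarrow> nat" where
  "min_degree G = Min (degree G ` verts G)"

definition delete_edges :: "'a graph \<Rightarrow> 'a set set \<Rightarrow> 'a graph" where
  "delete_edges G F = \<lparr> verts = verts G, edges = edges G - F \<rparr>"

end

theory Submission
  imports Defs
begin

text \<open>
  Take a bipartite graph \<open>H\<close> without \<open>K\<^bsub>t,t\<^esub>\<close> and with \<open>z(n;t)\<close> edges, with sides \<open>X\<close> and \<open>Z\<close> of
  size \<open>n\<close>, and a further part \<open>Y\<close> of size \<open>n\<close>. Put \<open>s = \<lceil>c/4 \<cdot> n\<^bsup>1-1/t\<^esup>\<rceil>\<close>. As \<open>H\<close> has at least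
  \<open>c n\<^bsup>2-1/t\<^esup>\<close> edges and no degree exceeds \<open>n\<close>, each side contains \<open>s\<close> vertices of degree at least
  \<open>s\<close> in \<open>H\<close> (\<open>exists_high_degree_vertices\<close>); call these sets \<open>X0\<close> and \<open>Z0\<close>. Choose \<open>Y1 \<subseteq> Y\<close> of size
  \<open>w = n/(3k)\<close>. Start with the following triangle-free graph:

  \<^item> \<open>X0\<close> is joined to all of \<open>Y\<close>, and \<open>X - X0\<close> to \<open>Y1\<close>;
  \<^item> \<open>Z0\<close> is joined to all of \<open>Y\<close>, and \<open>Z - Z0\<close> to \<open>Y - Y1\<close>;
  \<^item> \<open>X - X0\<close> is joined to \<open>Z - Z0\<close>.

  Here every vertex outside \<open>X0 \<union> Z0\<close> already has degree at least \<open>n + s\<close>, because \<open>s\<close> is sublinear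
  in \<open>n\<close> while \<open>w\<close> is linear. The vertices of \<open>X0 \<union> Z0\<close> have degree exactly \<open>n\<close>, and adding the
  edges of \<open>H\<close> gives them \<open>s\<close> more. A copy of \<open>K\<^bsub>t,t,t\<^esub>\<close> must respect the three parts, since its
  proper 3-colouring is unique up to renaming the colours. An edge between \<open>X\<close> and \<open>Z\<close> outside \<open>H\<close>
  lies in no triangle, so all \<open>t\<^sup>2\<close> edges of the copy between \<open>X\<close> and \<open>Z\<close> belong to \<open>H\<close>, which is
  impossible (\<open>K_ttt_free\<close>).

  The graphs for different \<open>k\<close> are told apart by their degrees. Up to \<open>O(s)\<close> vertices and \<open>O(s)\<close> in
  each degree, there are \<open>n\<close> vertices of each of the degrees \<open>n\<close> (in \<open>Y\<close>), \<open>n + w\<close> (in \<open>X\<close>) and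
  \<open>2n - w\<close> (in \<open>Z\<close>). For two values of \<open>w\<close> these degree sequences are incomparable: the graph with
  the smaller \<open>w\<close> wins in the top third and loses in the middle third. An embedding preserves the
  vertices and cannot lower degrees, so in both directions about \<open>n\<close> vertices must lose about
  \<open>|w - w'|\<close> edges each (\<open>deletions_ge_profile_gap\<close>).
\<close>

section \<open>Embeddings as injections\<close>

lemma embedsE:
  assumes "embeds H G"
  obtains f where "inj_on f (verts H)" "f ` verts H \<subseteq> verts G"
    "\<And>x y. x \<in> verts H \<Longrightarrow> y \<in> verts H \<Longrightarrow> {x, y} \<in> edges H \<Longrightarrow> {f x, f y} \<in> edges G"
proof -
  obtain S f where S: "subgraph S G" and f: "bij_betw f (verts H) (verts S)"
    and e: "\<forall>x\<in>verts H. \<forall>y\<in>verts H. {x, y} \<in> edges H \<longleftrightarrow> {f x, f y} \<in> edges S"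
    using assms unfolding embeds_def isomorphic_def by blast
  show thesis
  proof (rule that)
    show "inj_on f (verts H)" "f ` verts H \<subseteq> verts G"
      using S f by (auto simp: subgraph_def bij_betw_def)
    show "{f x, f y} \<in> edges G" if "x \<in> verts H" "y \<in> verts H" "{x, y} \<in> edges H" for x y
      using S e that by (auto simp: subgraph_def)
  qed
qed

lemma embedsI:
  assumes H: "simple_graph H" and f: "inj_on f (verts H)" "f ` verts H \<subseteq> verts G"
    and e: "\<And>x y. x \<in> verts H \<Longrightarrow> y \<in> verts H \<Longrightarrow> {x, y} \<in> edges H \<Longrightarrow> {f x, f y} \<in> edges G"
  shows "embeds H G"
proof -
  define S where "S = \<lparr>verts = f ` verts H, edges = (`) f ` edges H\<rparr>"
  have E: "a \<subseteq> verts H" "\<exists>x y. a = {x, y}" "card a = 2" if "a \<in> edges H" for a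
  proof -
    show "a \<subseteq> verts H" "card a = 2" using H that by (auto simp: simple_graph_def)
    then show "\<exists>x y. a = {x, y}" unfolding card_2_iff by blast
  qed
  have "subgraph S G"
    unfolding subgraph_def
  proof (intro conjI)
    show "simple_graph S"
      unfolding simple_graph_def
    proof (intro conjI ballI)
      show "finite (verts S)" using H by (simp add: S_def simple_graph_def)
      fix a assume "a \<in> edges S"
      then obtain b where b: "b \<in> edges H" "a = f ` b" by (auto simp: S_def)
      show "a \<subseteq> verts S" using b E(1)[OF b(1)] by (auto simp: S_def)
      show "card a = 2" using b E(3)[OF b(1)] card_image[OF inj_on_subset[OF f(1) E(1)[OF b(1)]]] by simp
    qed
    show "verts S \<subseteq> verts G" using f by (simp add: S_def)
    show "edges S \<subseteq> edges G"
    proof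
      fix a assume "a \<in> edges S"
      then obtain b where b: "b \<in> edges H" "a = f ` b" by (auto simp: S_def)
      obtain x y where "b = {x, y}" using E(2)[OF b(1)] by blast
      then show "a \<in> edges G" using e[of x y] E(1)[OF b(1)] b by simp
    qed
  qed
  moreover have "isomorphic H S"
    unfolding isomorphic_def
  proof (intro exI[of _ f] conjI ballI)
    show "bij_betw f (verts H) (verts S)" using f by (simp add: S_def bij_betw_def)
    fix x y assume xy: "x \<in> verts H" "y \<in> verts H"
    show "{x, y} \<in> edges H \<longleftrightarrow> {f x, f y} \<in> edges S"
    proof
      assume "{f x, f y} \<in> edges S"
      then obtain b where b: "b \<in> edges H" "f ` {x, y} = f ` b" by (auto simp: S_def)
      have "{x, y} = b"
        using inj_on_image_eq_iff[OF f(1) _ E(1)[OF b(1)], of "{x, y}"] b(2) xy by simp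
      then show "{x, y} \<in> edges H" using b by simp
    qed (use imageI[of "{x, y}" "edges H" "(`) f"] in \<open>simp add: S_def\<close>)
  qed
  ultimately show ?thesis unfolding embeds_def by blast
qed

lemma simple_complete_multipartite: "simple_graph (complete_multipartite r t)"
  by (auto simp: simple_graph_def complete_multipartite_def card_2_iff)

lemma verts_complete_multipartite: "verts (complete_multipartite r t) = {..<r} \<times> {..<t}"
  by (simp add: complete_multipartite_def)

lemma edge_complete_multipartite_iff:
  "{x, y} \<in> edges (complete_multipartite r t) \<longleftrightarrow>
     x \<in> {..<r} \<times> {..<t} \<and> y \<in> {..<r} \<times> {..<t} \<and> fst x \<noteq> fst y"
proof
  assume "{x, y} \<in> edges (complete_multipartite r t)"
  then obtain u v where "{x, y} = {u, v}" "u \<in> {..<r} \<times> {..<t}" "v \<in> {..<r} \<times> {..<t}" "fst u \<noteq> fst v"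
    unfolding complete_multipartite_def graph.simps mem_Collect_eq by blast
  then show "x \<in> {..<r} \<times> {..<t} \<and> y \<in> {..<r} \<times> {..<t} \<and> fst x \<noteq> fst y"
    unfolding doubleton_eq_iff by (elim disjE conjE) simp_all
next
  assume "x \<in> {..<r} \<times> {..<t} \<and> y \<in> {..<r} \<times> {..<t} \<and> fst x \<noteq> fst y"
  then show "{x, y} \<in> edges (complete_multipartite r t)"
    unfolding complete_multipartite_def graph.simps mem_Collect_eq by blast
qed

lemma embeds_complete_bipartiteI:
  assumes "finite A" "finite B" "card A = t" "card B = t" "A \<inter> B = {}" "A \<union> B \<subseteq> verts G"
    and "\<And>a b. a \<in> A \<Longrightarrow> b \<in> B \<Longrightarrow> {a, b} \<in> edges G"
  shows "embeds (complete_multipartite 2 t) G"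
proof -
  obtain g h where g: "bij_betw g {..<t} A" and h: "bij_betw h {..<t} B"
    using assms(1-4) by (metis ex_bij_betw_nat_finite lessThan_atLeast0)
  define f where "f p = (if fst p = 0 then g (snd p) else h (snd p))" for p :: "nat \<times> nat"
  have gA: "g i \<in> A" and hB: "h i \<in> B" if "i < t" for i
    using g h that by (auto simp: bij_betw_def)
  show ?thesis
  proof (rule embedsI[OF simple_complete_multipartite])
    show "inj_on f (verts (complete_multipartite 2 t))"
    proof (rule inj_onI)
      fix p q assume p: "p \<in> verts (complete_multipartite 2 t)"
        and q: "q \<in> verts (complete_multipartite 2 t)" and eq: "f p = f q"
      then have "fst p < 2" "snd p < t" "fst q < 2" "snd q < t"
        by (auto simp: complete_multipartite_def)
      moreover from this have "fst p = 0 \<longleftrightarrow> fst q = 0"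
        using eq gA hB assms(5) unfolding f_def by (metis disjoint_iff)
      ultimately show "p = q"
        using eq g h unfolding f_def bij_betw_def
        by (cases p; cases q) (auto split: if_splits dest: inj_onD)
    qed
    show "f ` verts (complete_multipartite 2 t) \<subseteq> verts G"
      using gA hB assms(6) by (auto simp: complete_multipartite_def f_def)
    fix p q assume "{p, q} \<in> edges (complete_multipartite 2 t)"
    then have "fst p < 2" "snd p < t" "fst q < 2" "snd q < t" "fst p \<noteq> fst q"
      by (auto simp: edge_complete_multipartite_iff)
    then show "{f p, f q} \<in> edges G"
      using assms(7)[OF gA hB] by (auto simp: f_def insert_commute)
  qed
qed

text \<open>In a complete tripartite graph any two vertices of one class have two common neighbours that are
  adjacent, one in each other class, and these already use two colours; so a proper 3-colouring is constant on classes.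
  The classes can therefore be indexed by the colours of the host graph.\<close>

lemma complete_tripartite_classes:
  assumes emb: "embeds (complete_multipartite 3 t) G" and t: "t \<ge> 1"
    and col: "\<And>v. v \<in> verts G \<Longrightarrow> col v < (3::nat)"
      "\<And>u v. {u, v} \<in> edges G \<Longrightarrow> col u \<noteq> col v"
  obtains T where "\<And>a. a < 3 \<Longrightarrow> T a \<subseteq> {v \<in> verts G. col v = a}"
    "\<And>a. a < 3 \<Longrightarrow> card (T a) = t"
    "\<And>a b u v. a < 3 \<Longrightarrow> b < 3 \<Longrightarrow> a \<noteq> b \<Longrightarrow> u \<in> T a \<Longrightarrow> v \<in> T b \<Longrightarrow> {u, v} \<in> edges G"
proof -
  obtain f :: "nat \<times> nat \<Rightarrow> 'a" where f: "inj_on f ({..<3} \<times> {..<t})" "f ` ({..<3} \<times> {..<t}) \<subseteq> verts G"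
    and e: "\<And>i j k l. i < 3 \<Longrightarrow> j < t \<Longrightarrow> k < 3 \<Longrightarrow> l < t \<Longrightarrow> i \<noteq> k \<Longrightarrow>
      {f (i, j), f (k, l)} \<in> edges G"
    using emb
  proof (rule embedsE)
    fix f :: "nat \<times> nat \<Rightarrow> 'a"
    assume "inj_on f (verts (complete_multipartite 3 t))"
      "f ` verts (complete_multipartite 3 t) \<subseteq> verts G"
      "\<And>x y. x \<in> verts (complete_multipartite 3 t) \<Longrightarrow> y \<in> verts (complete_multipartite 3 t) \<Longrightarrow>
        {x, y} \<in> edges (complete_multipartite 3 t) \<Longrightarrow> {f x, f y} \<in> edges G"
    then show thesis
      by (intro that[of f]) (auto simp: edge_complete_multipartite_iff verts_complete_multipartite)
  qed
  \<comment> \<open>The colour of class \<open>i\<close>, read off from its first vertex; \<open>p\<close> turns out to be a permutation.\<close>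
  define p where "p i = col (f (i, 0))" for i
  have pneq: "col (f (i, j)) \<noteq> p k" if "i < 3" "j < t" "k < 3" "i \<noteq> k" for i j k
    unfolding p_def using col(2)[OF e[of i j k 0]] that t by auto
  have plt: "col (f (i, j)) < 3" if "i < 3" "j < t" for i j
    using col(1) f(2) that by auto
  have pinj: "inj_on p {..<3}"
    using pneq[of _ 0] t by (auto simp: inj_on_def p_def)
  have psurj: "p ` {..<3} = {..<3}"
  proof (rule card_subset_eq)
    show "p ` {..<3} \<subseteq> {..<3}" using plt[of _ 0] t by (auto simp: p_def)
    show "card (p ` {..<3}) = card {..<3::nat}" using pinj by (rule card_image)
  qed simp
  have peq: "col (f (i, j)) = p i" if "i < 3" "j < t" for i j
  proof -
    have "col (f (i, j)) \<in> p ` {..<3}" using plt[OF that] psurj by simp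
    then show ?thesis using pneq[OF that] by (metis imageE lessThan_iff)
  qed
  define q where "q = inv_into {..<3} p"
  have q: "q a < 3" "p (q a) = a" if "a < 3" for a
    unfolding q_def using that psurj by (metis inv_into_into lessThan_iff, metis f_inv_into_f lessThan_iff)
  show thesis
  proof (rule that[of "\<lambda>a. f ` ({q a} \<times> {..<t})"])
    fix a :: nat assume a: "a < 3"
    show "f ` ({q a} \<times> {..<t}) \<subseteq> {v \<in> verts G. col v = a}"
      using q[OF a] f(2) peq[OF q(1)[OF a]] by auto
    have "inj_on f ({q a} \<times> {..<t})"
      by (rule inj_on_subset[OF f(1)]) (use q[OF a] in auto)
    then show "card (f ` ({q a} \<times> {..<t})) = t" by (simp add: card_image)
    fix b u v assume b: "b < 3" "a \<noteq> b" "u \<in> f ` ({q a} \<times> {..<t})" "v \<in> f ` ({q b} \<times> {..<t})"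
    then have "q a \<noteq> q b" using q a by metis
    then show "{u, v} \<in> edges G" using e q a b by auto
  qed
qed

section \<open>Degree sequences and deletion distance\<close>

lemma sum_degrees_le:
  assumes "finite F" "finite T" "\<And>e. e \<in> F \<Longrightarrow> card e = 2"
  shows "(\<Sum>v\<in>T. card {u. {v, u} \<in> F}) \<le> 2 * card F"
proof -
  have "card {u. {v, u} \<in> F} \<le> card {e \<in> F. v \<in> e}" for v
  proof -
    have "inj_on (\<lambda>u. {v, u}) {u. {v, u} \<in> F}" by (auto simp: inj_on_def doubleton_eq_iff)
    then show ?thesis using assms(1) by (intro card_inj_on_le[of "\<lambda>u. {v, u}"]) auto
  qed
  then have "(\<Sum>v\<in>T. card {u. {v, u} \<in> F}) \<le> (\<Sum>v\<in>T. card {e \<in> F. v \<in> e})"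
    by (rule sum_mono)
  also have "\<dots> = (\<Sum>e\<in>F. card {v \<in> T. v \<in> e})"
    using sum_multicount_gen[OF assms(2,1), of "\<lambda>v e. v \<in> e" "\<lambda>e. card {v \<in> T. v \<in> e}"] by simp
  also have "\<dots> \<le> (\<Sum>e\<in>F. 2)"
  proof (rule sum_mono)
    fix e assume "e \<in> F"
    then have "card e = 2" by (rule assms(3))
    then show "card {v \<in> T. v \<in> e} \<le> 2"
      using card_mono[of e "{v \<in> T. v \<in> e}"] card_ge_0_finite[of e] by auto
  qed
  finally show ?thesis by simp
qed

lemma finite_simple_graph:
  assumes "simple_graph G"
  shows "finite (edges G)" "finite {u. {v, u} \<in> edges G}" "finite (verts G)"
proof -
  show V: "finite (verts G)" using assms by (simp add: simple_graph_def)
  have "edges G \<subseteq> Pow (verts G)" using assms by (auto simp: simple_graph_def)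
  then show "finite (edges G)" using V finite_subset by blast
  have "{u. {v, u} \<in> edges G} \<subseteq> verts G" using assms by (auto simp: simple_graph_def)
  then show "finite {u. {v, u} \<in> edges G}" using V finite_subset by blast
qed

text \<open>At least \<open>A - B\<close> vertices of degree at least \<open>D\<close> are sent to vertices of degree at most \<open>D'\<close>,
  so each of them loses \<open>D - D'\<close> edges; every deleted edge is counted at most twice.\<close>

lemma deletions_ge_degree_gap:
  assumes G: "simple_graph G" and G': "simple_graph G'" and F: "F \<subseteq> edges G"
    and emb: "embeds (delete_edges G F) G'"
    and A: "A \<le> card {v \<in> verts G. degree G v \<ge> D}"
    and B: "card {v \<in> verts G'. degree G' v > D'} \<le> B"
  shows "(A - B) * (D - D') \<le> 2 * card F"
proof -
  obtain f where f: "inj_on f (verts G)" "f ` verts G \<subseteq> verts G'"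
    and fe: "\<And>x y. {x, y} \<in> edges G - F \<Longrightarrow> {f x, f y} \<in> edges G'"
    using emb
  proof (rule embedsE)
    fix f assume "inj_on f (verts (delete_edges G F))" "f ` verts (delete_edges G F) \<subseteq> verts G'"
      "\<And>x y. x \<in> verts (delete_edges G F) \<Longrightarrow> y \<in> verts (delete_edges G F) \<Longrightarrow>
         {x, y} \<in> edges (delete_edges G F) \<Longrightarrow> {f x, f y} \<in> edges G'"
    then show thesis
      using G by (intro that[of f]) (auto simp: delete_edges_def simple_graph_def)
  qed
  note fin = finite_simple_graph[OF G] finite_simple_graph[OF G']
  define S where "S = {v \<in> verts G. degree G v \<ge> D}"
  define S' where "S' = {v \<in> S. degree G' (f v) > D'}"
  have "finite S" using fin by (simp add: S_def)
  have "card S' \<le> card {v \<in> verts G'. degree G' v > D'}"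
    by (rule card_inj_on_le[of f]) (use f fin in \<open>auto simp: S'_def S_def inj_on_def\<close>)
  then have "card S' \<le> B" using B by linarith
  moreover have "card (S - S') = card S - card S'"
    using \<open>finite S\<close> by (intro card_Diff_subset) (auto simp: S'_def)
  ultimately have big: "A - B \<le> card (S - S')" using A by (simp add: S_def)
  have lost: "D - D' \<le> card {u. {v, u} \<in> F}" if v: "v \<in> S - S'" for v
  proof -
    have nb: "{u. {v, u} \<in> edges G} = {u. {v, u} \<in> edges G - F} \<union> {u. {v, u} \<in> F}"
      using F by auto
    have "D \<le> degree G v" using v by (simp add: S_def)
    also have "\<dots> \<le> card {u. {v, u} \<in> edges G - F} + card {u. {v, u} \<in> F}"
      unfolding degree_def nb by (rule card_Un_le)
    also have "card {u. {v, u} \<in> edges G - F} \<le> card {u. {f v, u} \<in> edges G'}"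
    proof (rule card_inj_on_le[of f])
      have "{u. {v, u} \<in> edges G - F} \<subseteq> verts G" using G by (auto simp: simple_graph_def)
      then show "inj_on f {u. {v, u} \<in> edges G - F}" by (rule inj_on_subset[OF f(1)])
      show "f ` {u. {v, u} \<in> edges G - F} \<subseteq> {u. {f v, u} \<in> edges G'}" using fe by auto
    qed (rule fin)
    also have "\<dots> \<le> D'" using v by (auto simp: S'_def S_def degree_def)
    finally show ?thesis by simp
  qed
  have "(A - B) * (D - D') \<le> card (S - S') * (D - D')" using big by simp
  also have "\<dots> \<le> (\<Sum>v\<in>S - S'. card {u. {v, u} \<in> F})"
    using sum_bounded_below[of "S - S'" "D - D'"] lost by simp
  also have "\<dots> \<le> 2 * card F"
    by (rule sum_degrees_le) (use F G fin \<open>finite S\<close> in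
      \<open>auto simp: simple_graph_def intro: finite_subset\<close>)
  finally show ?thesis .
qed

text \<open>For \<open>2w \<le> n\<close> and up to errors of order \<open>s\<close>: the largest \<open>n\<close> degrees are \<open>2n - w\<close> and the next \<open>n\<close> are
  \<open>n + w\<close>.\<close>

definition degree_profile :: "nat \<Rightarrow> nat \<Rightarrow> nat \<Rightarrow> 'a graph \<Rightarrow> bool" where
  "degree_profile n s w G \<longleftrightarrow>
     n - s \<le> card {v \<in> verts G. degree G v \<ge> 2 * n - w - s} \<and>
     card {v \<in> verts G. degree G v > 2 * n - w} \<le> 2 * s \<and>
     2 * n - 2 * s \<le> card {v \<in> verts G. degree G v \<ge> n + w - s} \<and>
     card {v \<in> verts G. degree G v > n + w} \<le> n + s"

text \<open>If \<open>w \<le> w'\<close>, the top \<open>n\<close> degrees of \<open>G\<close> are too large for \<open>G'\<close>; otherwise \<open>G\<close> has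
  about \<open>2n\<close> vertices of degree \<open>n + w\<close> or more, where \<open>G'\<close> has only about \<open>n\<close> of degree above
  \<open>n + w'\<close>. The factor \<open>(w - w') + (w' - w)\<close> is the distance of \<open>w\<close> and \<open>w'\<close> in truncated
  subtraction.\<close>

lemma deletions_ge_profile_gap:
  assumes "simple_graph G" "simple_graph G'" "F \<subseteq> edges G" "embeds (delete_edges G F) G'"
    and "degree_profile n s w G" "degree_profile n s w' G'" and "w \<le> n" "w' \<le> n"
  shows "(n - 3 * s) * ((w - w') + (w' - w) - s) \<le> 2 * card F"
proof (cases "w \<le> w'")
  case True
  have "(n - s - 2 * s) * ((2 * n - w - s) - (2 * n - w')) \<le> 2 * card F"
    by (rule deletions_ge_degree_gap[OF assms(1-4)]) (use assms in \<open>auto simp: degree_profile_def\<close>)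
  moreover have "(2 * n - w - s) - (2 * n - w') = (w - w') + (w' - w) - s" "n - s - 2 * s = n - 3 * s"
    using True assms by auto
  ultimately show ?thesis by simp
next
  case False
  have "(2 * n - 2 * s - (n + s)) * ((n + w - s) - (n + w')) \<le> 2 * card F"
    by (rule deletions_ge_degree_gap[OF assms(1-4)]) (use assms in \<open>auto simp: degree_profile_def\<close>)
  moreover have "(n + w - s) - (n + w') = (w - w') + (w' - w) - s"
    "2 * n - 2 * s - (n + s) = n - 3 * s"
    using False by auto
  ultimately show ?thesis by simp
qed

section \<open>The construction\<close>

locale tripartite_construction =
  fixes n s w :: nat and X X0 Y Y1 Z Z0 :: "'a set" and H :: "'a set set"
  assumes fin: "finite X" "finite Y" "finite Z"
    and disj: "X \<inter> Y = {}" "Y \<inter> Z = {}" "X \<inter> Z = {}"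
    and card: "card X = n" "card Y = n" "card Z = n"
    and sub: "X0 \<subseteq> X" "Y1 \<subseteq> Y" "Z0 \<subseteq> Z"
    and card_sub: "card X0 = s" "card Y1 = w" "card Z0 = s"
    and degX0: "\<And>x. x \<in> X0 \<Longrightarrow> card {z \<in> Z. {x, z} \<in> H} \<ge> s"
    and degZ0: "\<And>z. z \<in> Z0 \<Longrightarrow> card {x \<in> X. {z, x} \<in> H} \<ge> s"
    and bounds: "2 * s \<le> w" "w + 2 * s \<le> n"
begin

definition adj :: "'a \<Rightarrow> 'a \<Rightarrow> bool" where
  "adj u v \<longleftrightarrow>
     u \<in> X \<and> v \<in> Y \<and> (u \<in> X0 \<or> v \<in> Y1) \<or>
     u \<in> Z \<and> v \<in> Y \<and> (u \<in> Z0 \<or> v \<in> Y - Y1) \<or>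
     u \<in> X \<and> v \<in> Z \<and> (u \<notin> X0 \<and> v \<notin> Z0 \<or> {u, v} \<in> H)"

definition graph :: "'a graph" where
  "graph = \<lparr>verts = X \<union> Y \<union> Z, edges = {{u, v} |u v. adj u v}\<rparr>"

lemma verts_graph: "verts graph = X \<union> Y \<union> Z"
  by (simp add: graph_def)

lemma edge_iff: "{u, v} \<in> edges graph \<longleftrightarrow> adj u v \<or> adj v u"
  by (auto simp: graph_def doubleton_eq_iff)

lemma fin_sub: "finite X0" "finite Y1" "finite Z0"
  using sub fin finite_subset by blast+

text \<open>Exchanging \<open>X\<close> with \<open>Z\<close> and \<open>Y1\<close> with its complement in \<open>Y\<close> gives the same graph, so that
  degrees in \<open>Z\<close> can be read off from those in \<open>X\<close>.\<close>

lemma swap: "tripartite_construction n s (n - w) Z Z0 Y (Y - Y1) X X0 H"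
  using fin disj card sub card_sub degX0 degZ0 bounds fin_sub
  by unfold_locales (auto simp: card_Diff_subset Int_commute)

lemma graph_swap: "tripartite_construction.graph Z Z0 Y (Y - Y1) X X0 H = graph"
proof -
  interpret sw: tripartite_construction n s "n - w" Z Z0 Y "Y - Y1" X X0 H by (rule swap)
  have *: "sw.adj u v \<or> sw.adj v u \<longleftrightarrow> adj u v \<or> adj v u" for u v
    using sub unfolding sw.adj_def adj_def by (auto simp: insert_commute)
  have "e \<in> edges sw.graph \<longleftrightarrow> e \<in> edges graph" for e
  proof (cases "\<exists>u v. e = {u, v}")
    case True
    then show ?thesis using * sw.edge_iff edge_iff by auto
  next
    case False
    then show ?thesis by (auto simp: sw.graph_def graph_def)
  qed
  then show ?thesis
    by (auto simp: sw.verts_graph verts_graph intro!: graph.equality)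
qed

lemma simple: "simple_graph graph"
  unfolding simple_graph_def
proof (intro conjI ballI)
  show "finite (verts graph)" using fin by (simp add: verts_graph)
  fix e assume "e \<in> edges graph"
  then obtain u v where "e = {u, v}" "adj u v" by (auto simp: graph_def)
  moreover from this have "u \<noteq> v" using disj by (auto simp: adj_def)
  ultimately show "e \<subseteq> verts graph" "card e = 2"
    by (auto simp: adj_def verts_graph card_2_iff)
qed

lemma balanced: "balanced_multipartite 3 n graph"
  unfolding balanced_multipartite_def
proof (intro conjI exI)
  let ?P = "\<lambda>i::nat. if i = 0 then X else if i = 1 then Y else Z"
  have less3: "{..<3::nat} = {0, 1, 2}" by auto
  show "simple_graph graph" by (rule simple)
  show "disjoint_family_on ?P {..<3}"
    using disj by (auto simp: disjoint_family_on_def less3)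
  show "(\<Union>i<3. ?P i) = verts graph" by (auto simp: less3 verts_graph)
  show "\<forall>i<3. card (?P i) = n \<and> independent graph (?P i)"
    using card disj unfolding independent_def edge_iff adj_def by auto
qed

lemma nbrs_X:
  assumes "x \<in> X"
  shows "{u. {x, u} \<in> edges graph} =
    (if x \<in> X0 then Y else Y1) \<union>
    (if x \<in> X0 then {} else Z - Z0) \<union> {z \<in> Z. {x, z} \<in> H}"
proof -
  have "x \<notin> Y" "x \<notin> Z" using assms disj by auto
  then have "{x, u} \<in> edges graph \<longleftrightarrow> u \<in> Y \<and> (x \<in> X0 \<or> u \<in> Y1) \<or>
      u \<in> Z \<and> (x \<notin> X0 \<and> u \<notin> Z0 \<or> {x, u} \<in> H)" for u
    using assms unfolding edge_iff adj_def by simp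
  then show ?thesis using sub(2) by auto
qed

lemma nbrs_Y:
  assumes "y \<in> Y"
  shows "{u. {y, u} \<in> edges graph} = (if y \<in> Y1 then X \<union> Z0 else X0 \<union> Z)"
proof -
  have "y \<notin> X" "y \<notin> Z" using assms disj by auto
  then have "{y, u} \<in> edges graph \<longleftrightarrow> u \<in> X \<and> (u \<in> X0 \<or> y \<in> Y1) \<or>
      u \<in> Z \<and> (u \<in> Z0 \<or> y \<notin> Y1)" for u
    using assms unfolding edge_iff adj_def by simp
  then show ?thesis using sub(1,3) by auto
qed

lemma degree_X0:
  assumes "x \<in> X0" shows "degree graph x \<ge> n + s"
proof -
  have "degree graph x = card (Y \<union> {z \<in> Z. {x, z} \<in> H})"
    using assms sub nbrs_X[of x] by (auto simp: degree_def)
  also have "\<dots> = n + card {z \<in> Z. {x, z} \<in> H}"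
    using fin disj card by (subst card_Un_disjoint) auto
  finally show ?thesis using degX0[OF assms] by simp
qed

lemma degree_X1:
  assumes "x \<in> X - X0" shows "degree graph x \<ge> n + w - s" "degree graph x \<le> n + w"
proof -
  have N: "{u. {x, u} \<in> edges graph} = Y1 \<union> (Z - Z0 \<union> {z \<in> Z. {x, z} \<in> H})"
    using assms nbrs_X[of x] by auto
  have "card (Y1 \<union> (Z - Z0)) = w + (n - s)"
    using fin fin_sub disj sub card card_sub
    by (subst card_Un_disjoint) (auto simp: card_Diff_subset)
  moreover have "card (Y1 \<union> (Z - Z0)) \<le> degree graph x"
    unfolding degree_def N using fin fin_sub by (intro card_mono) auto
  ultimately show "degree graph x \<ge> n + w - s" using bounds by simp
  have "degree graph x \<le> card (Y1 \<union> Z)"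
    unfolding degree_def N using fin fin_sub by (intro card_mono) auto
  also have "\<dots> \<le> n + w" using card_Un_le[of Y1 Z] card card_sub by simp
  finally show "degree graph x \<le> n + w" .
qed

lemma degree_Y:
  assumes "y \<in> Y" shows "degree graph y = n + s"
proof -
  have "card (X \<union> Z0) = n + s" "card (X0 \<union> Z) = n + s"
    using fin fin_sub sub disj card card_sub by (subst card_Un_disjoint; auto)+
  then show ?thesis unfolding degree_def nbrs_Y[OF assms] by simp
qed

lemma degree_Z0:
  assumes "z \<in> Z0" shows "degree graph z \<ge> n + s"
  using tripartite_construction.degree_X0[OF swap assms] by (simp add: graph_swap)

lemma degree_Z1:
  assumes "z \<in> Z - Z0"
  shows "degree graph z \<ge> 2 * n - w - s" "degree graph z \<le> 2 * n - w"
  using tripartite_construction.degree_X1[OF swap assms] bounds by (simp_all add: graph_swap)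

lemma degree_ge:
  assumes "v \<in> verts graph" shows "degree graph v \<ge> n + s"
proof -
  consider "v \<in> X0" | "v \<in> X - X0" | "v \<in> Y" | "v \<in> Z0" | "v \<in> Z - Z0"
    using assms by (auto simp: verts_graph)
  then show ?thesis
    using degree_X0 degree_X1 degree_Y degree_Z0 degree_Z1 bounds by cases fastforce+
qed

lemma profile:
  assumes "2 * w \<le> n" shows "degree_profile n s w graph"
  unfolding degree_profile_def
proof (intro conjI)
  note fin_verts = finite_simple_graph(3)[OF simple]
  have cX: "card (X - X0) = n - s" and cZ: "card (Z - Z0) = n - s"
    using fin_sub sub card card_sub by (simp_all add: card_Diff_subset)
  show "n - s \<le> card {v \<in> verts graph. degree graph v \<ge> 2 * n - w - s}"
    unfolding cZ[symmetric] using fin_verts degree_Z1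
    by (intro card_mono) (auto simp: verts_graph)
  have "{v \<in> verts graph. degree graph v > 2 * n - w} \<subseteq> X0 \<union> Z0"
  proof
    fix v assume v: "v \<in> {v \<in> verts graph. degree graph v > 2 * n - w}"
    show "v \<in> X0 \<union> Z0"
    proof (rule ccontr)
      assume "v \<notin> X0 \<union> Z0"
      then consider "v \<in> X - X0" | "v \<in> Y" | "v \<in> Z - Z0"
        using v by (auto simp: verts_graph)
      then show False
        using v degree_X1(2)[of v] degree_Y[of v] degree_Z1(2)[of v] bounds assms by cases auto
    qed
  qed
  then have "card {v \<in> verts graph. degree graph v > 2 * n - w} \<le> card (X0 \<union> Z0)"
    using fin_sub by (intro card_mono) auto
  also have "\<dots> \<le> 2 * s" using card_Un_le[of X0 Z0] card_sub by simp
  finally show "card {v \<in> verts graph. degree graph v > 2 * n - w} \<le> 2 * s" .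
  have "2 * n - 2 * s = card ((X - X0) \<union> (Z - Z0))"
    using fin disj cX cZ by (subst card_Un_disjoint) auto
  also have "\<dots> \<le> card {v \<in> verts graph. degree graph v \<ge> n + w - s}"
  proof (intro card_mono subsetI)
    fix v assume "v \<in> (X - X0) \<union> (Z - Z0)"
    then show "v \<in> {v \<in> verts graph. degree graph v \<ge> n + w - s}"
      using degree_X1(1)[of v] degree_Z1(1)[of v] assms by (auto simp: verts_graph)
  qed (use fin_verts in simp)
  finally show "2 * n - 2 * s \<le> card {v \<in> verts graph. degree graph v \<ge> n + w - s}" .
  have "{v \<in> verts graph. degree graph v > n + w} \<subseteq> X0 \<union> Z"
  proof
    fix v assume v: "v \<in> {v \<in> verts graph. degree graph v > n + w}"
    show "v \<in> X0 \<union> Z"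
    proof (rule ccontr)
      assume "v \<notin> X0 \<union> Z"
      then consider "v \<in> X - X0" | "v \<in> Y"
        using v by (auto simp: verts_graph)
      then show False
        using v degree_X1(2)[of v] degree_Y[of v] bounds by cases auto
    qed
  qed
  then have "card {v \<in> verts graph. degree graph v > n + w} \<le> card (X0 \<union> Z)"
    using fin fin_sub by (intro card_mono) auto
  also have "\<dots> \<le> n + s" using card_Un_le[of X0 Z] card card_sub by simp
  finally show "card {v \<in> verts graph. degree graph v > n + w} \<le> n + s" .
qed

text \<open>An edge \<open>xz\<close> of the graph between \<open>X\<close> and \<open>Z\<close> that is not in \<open>H\<close> joins \<open>X - X0\<close> to
  \<open>Z - Z0\<close>; a common neighbour in \<open>Y\<close> would lie both in \<open>Y1\<close> and in \<open>Y - Y1\<close>.\<close>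

lemma K_ttt_free:
  assumes t: "t \<ge> 1"
    and free: "\<And>A B. A \<subseteq> X \<Longrightarrow> B \<subseteq> Z \<Longrightarrow> card A = t \<Longrightarrow> card B = t \<Longrightarrow>
      \<exists>a\<in>A. \<exists>b\<in>B. {a, b} \<notin> H"
  shows "\<not> embeds (complete_multipartite 3 t) graph"
proof
  assume emb: "embeds (complete_multipartite 3 t) graph"
  define col where "col v = (if v \<in> X then 0 else if v \<in> Y then 1 else 2::nat)" for v
  have c3: "col v < 3" for v by (simp add: col_def)
  have proper: "col u \<noteq> col v" if "{u, v} \<in> edges graph" for u v
  proof -
    have "\<not> (a \<in> X \<and> a \<in> Y)" "\<not> (a \<in> Y \<and> a \<in> Z)" "\<not> (a \<in> X \<and> a \<in> Z)" for a
      using disj by auto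
    note this[of u] this[of v]
    then show ?thesis using that unfolding edge_iff adj_def col_def by (auto split: if_splits)
  qed
  obtain T where T: "\<And>a. a < 3 \<Longrightarrow> T a \<subseteq> {v \<in> verts graph. col v = a}"
    "\<And>a. a < 3 \<Longrightarrow> card (T a) = t"
    "\<And>a b u v. a < 3 \<Longrightarrow> b < 3 \<Longrightarrow> a \<noteq> b \<Longrightarrow> u \<in> T a \<Longrightarrow> v \<in> T b \<Longrightarrow> {u, v} \<in> edges graph"
  proof (rule complete_tripartite_classes[OF emb t c3 proper])
    fix T assume "\<And>a. a < 3 \<Longrightarrow> T a \<subseteq> {v \<in> verts graph. col v = a}"
      "\<And>a. a < 3 \<Longrightarrow> card (T a) = t"
      "\<And>a b u v. a < 3 \<Longrightarrow> b < 3 \<Longrightarrow> a \<noteq> b \<Longrightarrow> u \<in> T a \<Longrightarrow> v \<in> T b \<Longrightarrow> {u, v} \<in> edges graph"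
    then show thesis by (rule that[of T])
  qed
  have TX: "T 0 \<subseteq> X" and TY: "T 1 \<subseteq> Y" and TZ: "T 2 \<subseteq> Z"
    using T(1)[of 0] T(1)[of 1] T(1)[of 2] by (auto simp: col_def verts_graph split: if_splits)
  obtain x z where x: "x \<in> T 0" and z: "z \<in> T 2" and "{x, z} \<notin> H"
    using free[OF TX TZ T(2) T(2)] by auto
  have "T 1 \<noteq> {}" using T(2)[of 1] t by auto
  then obtain y where y: "y \<in> T 1" by blast
  have "{x, y} \<in> edges graph" "{z, y} \<in> edges graph" "{x, z} \<in> edges graph"
    using T(3)[of 0 1 x y] T(3)[of 2 1 z y] T(3)[of 0 2 x z] x y z by auto
  then show False
  proof -
    have "x \<in> X" "y \<in> Y" "z \<in> Z" using x y z TX TY TZ by auto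
    moreover from this have "x \<notin> Y" "x \<notin> Z" "y \<notin> X" "y \<notin> Z" "z \<notin> X" "z \<notin> Y" using disj by auto
    moreover note \<open>{x, y} \<in> edges graph\<close> \<open>{z, y} \<in> edges graph\<close> \<open>{x, z} \<in> edges graph\<close>
    ultimately show ?thesis using \<open>{x, z} \<notin> H\<close> unfolding edge_iff adj_def by simp
  qed
qed

end

section \<open>Dense bipartite graphs without \<open>K\<^bsub>t,t\<^esub>\<close>\<close>

lemma obtain_zarankiewicz_extremal:
  assumes "t \<ge> 1"
  obtains G :: "nat graph" where "balanced_multipartite 2 n G"
    "\<not> embeds (complete_multipartite 2 t) G" "card (edges G) = zarankiewicz n t"
proof -
  let ?\<G> = "{card (edges G) |G :: nat graph.
    balanced_multipartite 2 n G \<and> \<not> embeds (complete_multipartite 2 t) G}"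
  have "?\<G> \<subseteq> {..2 ^ (2 * n)}"
  proof
    fix m assume "m \<in> ?\<G>"
    then obtain G :: "nat graph" where m: "m = card (edges G)" and G: "balanced_multipartite 2 n G"
      by blast
    then obtain P :: "nat \<Rightarrow> nat set" where P: "(\<Union>i<2. P i) = verts G" "\<forall>i<2. card (P i) = n" and "simple_graph G"
      by (auto simp: balanced_multipartite_def)
    have "verts G = P 0 \<union> P 1" using P(1) by (auto simp: numeral_2_eq_2 lessThan_Suc)
    then have "card (verts G) \<le> 2 * n" using P(2) card_Un_le[of "P 0" "P 1"] by simp
    moreover have "card (edges G) \<le> card (Pow (verts G))"
      using \<open>simple_graph G\<close> by (intro card_mono) (auto simp: simple_graph_def)
    ultimately have "card (edges G) \<le> 2 ^ (2 * n)"
      using \<open>simple_graph G\<close> by (simp add: card_Pow simple_graph_def)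
        (meson le_trans one_le_numeral power_increasing)
    then show "m \<in> {..2 ^ (2 * n)}" using m by simp
  qed
  then have "finite ?\<G>" by (rule finite_subset) simp
  moreover have "?\<G> \<noteq> {}"
  proof -
    define G :: "nat graph" where "G = \<lparr>verts = {..<2 * n}, edges = {}\<rparr>"
    have "balanced_multipartite 2 n G"
      unfolding balanced_multipartite_def
    proof (intro conjI exI)
      let ?P = "\<lambda>i. {i * n..<Suc i * n}"
      show "disjoint_family_on ?P {..<2}"
        by (auto simp: disjoint_family_on_def numeral_2_eq_2 less_Suc_eq)
      show "(\<Union>i<2. ?P i) = verts G" by (auto simp: G_def numeral_2_eq_2 lessThan_Suc)
    qed (auto simp: G_def simple_graph_def independent_def)
    moreover have "\<not> embeds (complete_multipartite 2 t) G"
    proof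
      assume "embeds (complete_multipartite 2 t) G"
      then show False
      proof (rule embedsE)
        fix f assume "\<And>x y. x \<in> verts (complete_multipartite 2 t) \<Longrightarrow>
          y \<in> verts (complete_multipartite 2 t) \<Longrightarrow>
          {x, y} \<in> edges (complete_multipartite 2 t) \<Longrightarrow> {f x, f y} \<in> edges G"
        from this[of "(0, 0)" "(1, 0)"] show False
          using assms
          by (simp add: edge_complete_multipartite_iff verts_complete_multipartite G_def)
      qed
    qed
    ultimately show ?thesis by blast
  qed
  ultimately have "zarankiewicz n t \<in> ?\<G>" unfolding zarankiewicz_def by (rule Max_in)
  then obtain G :: "nat graph" where "zarankiewicz n t = card (edges G)"
    "balanced_multipartite 2 n G" "\<not> embeds (complete_multipartite 2 t) G" by blast
  then show thesis by (intro that) simp_all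
qed

text \<open>If fewer than \<open>s\<close> vertices of \<open>X\<close> had degree at least \<open>s\<close>, these would carry at most
  \<open>(s - 1) n\<close> edges and all remaining vertices together at most \<open>n (s - 1)\<close>.\<close>

lemma exists_high_degree_vertices:
  assumes "finite X" "finite Z" "card X = n" "card Z = n"
    and E: "\<And>e. e \<in> E \<Longrightarrow> \<exists>x\<in>X. \<exists>z\<in>Z. e = {x, z}"
    and many: "2 * n * (s - 1) < card E"
  shows "\<exists>S\<subseteq>X. card S = s \<and> (\<forall>x\<in>S. card {z \<in> Z. {x, z} \<in> E} \<ge> s)"
proof -
  let ?d = "\<lambda>x. card {z \<in> Z. {x, z} \<in> E}"
  define L where "L = {x \<in> X. ?d x \<ge> s}"
  have "E \<subseteq> (\<Union>x\<in>X. (\<lambda>z. {x, z}) ` {z \<in> Z. {x, z} \<in> E})" using E by force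
  then have "card E \<le> card (\<Union>x\<in>X. (\<lambda>z. {x, z}) ` {z \<in> Z. {x, z} \<in> E})"
    using assms(1,2) by (intro card_mono) auto
  also have "\<dots> \<le> (\<Sum>x\<in>X. card ((\<lambda>z. {x, z}) ` {z \<in> Z. {x, z} \<in> E}))"
    using assms(1) by (rule card_UN_le)
  also have "\<dots> \<le> (\<Sum>x\<in>X. ?d x)"
    using assms(2) by (intro sum_mono card_image_le) simp
  also have "\<dots> = (\<Sum>x\<in>L. ?d x) + (\<Sum>x\<in>X - L. ?d x)"
    using sum.subset_diff[of L X ?d] assms(1) by (simp add: L_def)
  finally have "card E \<le> (\<Sum>x\<in>L. ?d x) + (\<Sum>x\<in>X - L. ?d x)" .
  moreover have "?d x \<le> n" for x
    using card_mono[OF assms(2), of "{z \<in> Z. {x, z} \<in> E}"] assms(4) by auto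
  then have "(\<Sum>x\<in>L. ?d x) \<le> card L * n"
    using sum_bounded_above[of L ?d n] by simp
  moreover have "(\<Sum>x\<in>X - L. ?d x) \<le> n * (s - 1)"
  proof -
    have "?d x \<le> s - 1" if "x \<in> X - L" for x using that by (auto simp: L_def)
    then have "(\<Sum>x\<in>X - L. ?d x) \<le> card (X - L) * (s - 1)"
      using sum_bounded_above[of "X - L" ?d "s - 1"] by simp
    also have "\<dots> \<le> n * (s - 1)"
      using assms(1,3) card_mono[of X "X - L"] by (intro mult_le_mono1) auto
    finally show ?thesis .
  qed
  ultimately have "card E \<le> card L * n + n * (s - 1)" by linarith
  then have "n * (s - 1) < n * card L" using many by (simp add: algebra_simps)
  then have "s \<le> card L" by (simp, linarith)
  then obtain S where "S \<subseteq> L" "card S = s" by (metis obtain_subset_with_card_n)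
  then show ?thesis by (intro exI[of _ S]) (auto simp: L_def)
qed

lemma exists_tripartite_graph:
  assumes t: "t \<ge> 1" and z: "2 * n * (s - 1) < zarankiewicz n t"
    and sw: "2 * s \<le> w" "3 * w \<le> n"
  shows "\<exists>G :: nat graph. balanced_multipartite 3 n G \<and>
    \<not> embeds (complete_multipartite 3 t) G \<and>
    (\<forall>v\<in>verts G. degree G v \<ge> n + s) \<and> degree_profile n s w G"
proof -
  obtain H :: "nat graph" where H: "balanced_multipartite 2 n H"
    and free: "\<not> embeds (complete_multipartite 2 t) H" and cH: "card (edges H) = zarankiewicz n t"
    by (rule obtain_zarankiewicz_extremal[OF t])
  obtain P :: "nat \<Rightarrow> nat set" where P: "disjoint_family_on P {..<2}" "(\<Union>i<2. P i) = verts H"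
    "\<forall>i<2. card (P i) = n \<and> independent H (P i)" and simple: "simple_graph H"
    using H by (auto simp: balanced_multipartite_def)
  define X Z where "X = P 0" and "Z = P 1"
  have VH: "verts H = X \<union> Z" using P(2) by (auto simp: X_def Z_def numeral_2_eq_2 lessThan_Suc)
  have XZ: "X \<inter> Z = {}" using P(1) by (auto simp: X_def Z_def disjoint_family_on_def)
  have fin: "finite X" "finite Z" using VH simple by (auto simp: simple_graph_def)
  have card: "card X = n" "card Z = n" using P(3) by (auto simp: X_def Z_def)
  have E: "\<exists>x\<in>X. \<exists>z\<in>Z. e = {x, z}" if "e \<in> edges H" for e
  proof -
    have "e \<subseteq> X \<union> Z" "card e = 2" using simple that VH by (auto simp: simple_graph_def)
    then obtain a b where ab: "e = {a, b}" "a \<in> X \<union> Z" "b \<in> X \<union> Z"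
      unfolding card_2_iff by blast
    have "independent H X" "independent H Z" using P(3) by (auto simp: X_def Z_def)
    then have "\<not> (a \<in> X \<and> b \<in> X)" "\<not> (a \<in> Z \<and> b \<in> Z)"
      using ab(1) that unfolding independent_def by blast+
    then consider "a \<in> X" "b \<in> Z" | "b \<in> X" "a \<in> Z" using ab(2,3) by blast
    then show ?thesis
    proof cases
      case 2
      then show ?thesis using ab(1) insert_commute[of a b "{}"] by blast
    qed (use ab(1) in blast)
  qed
  have E': "\<exists>z\<in>Z. \<exists>x\<in>X. e = {z, x}" if "e \<in> edges H" for e
    using E[OF that] insert_commute by blast
  obtain X0 where X0: "X0 \<subseteq> X" "card X0 = s"
    "\<forall>x\<in>X0. card {z \<in> Z. {x, z} \<in> edges H} \<ge> s"
    using exists_high_degree_vertices[OF fin card E, where s = s and E = "edges H"] z cH by auto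
  obtain Z0 where Z0: "Z0 \<subseteq> Z" "card Z0 = s"
    "\<forall>z\<in>Z0. card {x \<in> X. {z, x} \<in> edges H} \<ge> s"
    using exists_high_degree_vertices[OF fin(2,1) card(2,1) E', where s = s and E = "edges H"] z cH by auto
  have "infinite (- (X \<union> Z))" using fin by (simp add: Compl_eq_Diff_UNIV)
  then obtain Y where Y: "Y \<subseteq> - (X \<union> Z)" "finite Y" "card Y = n"
    using infinite_arbitrarily_large[of "- (X \<union> Z)" n] by blast
  obtain Y1 where Y1: "Y1 \<subseteq> Y" "card Y1 = w"
  proof (rule obtain_subset_with_card_n[of w Y])
    show "w \<le> card Y" using sw Y by linarith
  qed
  interpret tripartite_construction n s w X X0 Y Y1 Z Z0 "edges H"
    using fin Y card X0 Y1 Z0 XZ sw by unfold_locales auto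
  have "\<exists>a\<in>A. \<exists>b\<in>B. {a, b} \<notin> edges H"
    if "A \<subseteq> X" "B \<subseteq> Z" "card A = t" "card B = t" for A B
    using embeds_complete_bipartiteI[of A B t H] free that fin XZ VH finite_subset by blast
  then have "\<not> embeds (complete_multipartite 3 t) graph" by (rule K_ttt_free[OF t])
  then show ?thesis using balanced degree_ge profile sw by (intro exI[of _ graph]) auto
qed

section \<open>Choice of the parameters\<close>

lemma min_degree_geI:
  assumes G: "balanced_multipartite r n G" and "r > 0" "n > 0"
    and deg: "\<forall>v\<in>verts G. m \<le> degree G v"
  shows "m \<le> min_degree G"
proof -
  obtain P :: "nat \<Rightarrow> 'a set" where P: "(\<Union>i<r. P i) = verts G" "\<forall>i<r. card (P i) = n"
    using G by (auto simp: balanced_multipartite_def)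
  have "P 0 \<noteq> {}" using P(2) assms(2,3) by auto
  moreover have "P 0 \<subseteq> verts G" using P(1) assms(2) by blast
  ultimately have "verts G \<noteq> {}" by blast
  moreover have "finite (verts G)"
    using G by (simp add: balanced_multipartite_def simple_graph_def)
  ultimately show ?thesis using deg by (simp add: min_degree_def)
qed

lemma eventually_ceiling_powr_le:
  fixes c a \<eta> :: real
  assumes "a < 1" "\<eta> > 0"
  shows "eventually (\<lambda>n. real (nat \<lceil>c * real n powr a\<rceil>) \<le> \<eta> * real n) sequentially"
proof -
  have "((\<lambda>n. c * real n powr (a - 1) + 1 / real n) \<longlongrightarrow> c * 0 + 0) sequentially"
    using assms by (intro tendsto_add tendsto_mult tendsto_const tendsto_neg_powr
      filterlim_real_sequentially lim_1_over_n) auto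
  then have "eventually (\<lambda>n. c * real n powr (a - 1) + 1 / real n < \<eta>) sequentially"
    using assms(2) by (intro order_tendstoD(2)) auto
  then show ?thesis using eventually_gt_at_top[of 0]
  proof eventually_elim
    case (elim n)
    have "c * real n powr a + 1 = (c * real n powr (a - 1) + 1 / real n) * real n"
      using elim by (simp add: powr_diff field_simps)
    also have "\<dots> \<le> \<eta> * real n" using elim by (intro mult_right_mono) auto
    finally have "c * real n powr a + 1 \<le> \<eta> * real n" .
    moreover have "0 \<le> \<eta> * real n" using assms by simp
    ultimately show ?case by linarith
  qed
qed

theorem theorem2p1:
  fixes t :: nat and c C :: real
  assumes "t \<ge> 1" and "c > 0" and "C > 0"
    and "\<forall>n::nat. n \<ge> 1 \<longrightarrow>
           c * real n powr (2 - 1 / real t) \<le> real (zarankiewicz n t) \<and>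
           real (zarankiewicz n t) \<le> C * real n powr (2 - 1 / real t)"
  shows "\<exists>(G :: nat \<Rightarrow> nat \<Rightarrow> nat graph) (N :: nat \<Rightarrow> nat).
    (\<forall>k n. real k \<ge> 2 * C / (3 * c) \<and> n \<ge> N k \<and> 3 * k dvd n \<longrightarrow>
       balanced_multipartite 3 n (G k n) \<and>
       \<not> embeds (complete_multipartite 3 t) (G k n) \<and>
       real (min_degree (G k n)) \<ge> real n + c / 4 * real n powr (1 - 1 / real t)) \<and>
    (\<forall>k k'. real k \<ge> 2 * C / (3 * c) \<and> real k' \<ge> 2 * C / (3 * c) \<and> k \<noteq> k' \<longrightarrow>
       (\<exists>\<epsilon>>0. \<exists>M. \<forall>n. n \<ge> M \<and> n \<ge> N k \<and> n \<ge> N k' \<and> 3 * k dvd n \<and> 3 * k' dvd n \<longrightarrow>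
          (\<forall>F. F \<subseteq> edges (G k n) \<and> embeds (delete_edges (G k n) F) (G k' n) \<longrightarrow>
             real (card F) \<ge> \<epsilon> * (real n)\<^sup>2)))"
proof -
  define s where "s n = nat \<lceil>c / 4 * real n powr (1 - 1 / real t)\<rceil>" for n
  define w where "w k n = n div (3 * k)" for k n :: nat
  have small: "\<exists>N. \<forall>n\<ge>N. real (s n) \<le> \<eta> * real n" if "\<eta> > 0" for \<eta>
    using eventually_ceiling_powr_le[of "1 - 1 / real t" \<eta> "c / 4"] that assms(1)
    by (auto simp: s_def eventually_sequentially)
  have k_pos: "k > 0" if "real k \<ge> 2 * C / (3 * c)" for k
  proof -
    have "2 * C / (3 * c) > 0" using assms by simp
    then show ?thesis using that by (cases k) auto
  qed
  have w_eq: "real (w k n) = real n / (3 * real k)" if "3 * k dvd n" for k n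
    using that by (simp add: w_def real_of_nat_div)
  \<comment> \<open>The bound \<open>n / (6k)\<close> is half of \<open>w k n\<close>: beyond \<open>N k\<close>, \<open>2 * s n \<le> w k n\<close>.\<close>
  have "\<exists>N\<ge>1. \<forall>n\<ge>N. k > 0 \<longrightarrow> real (s n) \<le> 1 / (6 * real k) * real n" for k
  proof (cases "k > 0")
    case True
    then obtain N where "\<forall>n\<ge>N. real (s n) \<le> 1 / (6 * real k) * real n"
      using small[of "1 / (6 * real k)"] by auto
    then show ?thesis by (intro exI[of _ "max 1 N"]) auto
  qed auto
  then obtain N where N1: "\<And>k. N k \<ge> 1"
    and N: "\<And>k n. n \<ge> N k \<Longrightarrow> k > 0 \<Longrightarrow> real (s n) \<le> 1 / (6 * real k) * real n"
    by metis
  \<comment> \<open>Everything that the two assertions require of a single graph, so that the family can be chosen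
    pointwise.\<close>
  define good where "good k n G \<longleftrightarrow> balanced_multipartite 3 n G \<and>
    \<not> embeds (complete_multipartite 3 t) G \<and>
    (\<forall>v\<in>verts G. degree G v \<ge> n + s n) \<and> degree_profile n (s n) (w k n) G"
    for k n and G :: "nat graph"
  define G where "G k n = (SOME G. good k n G)" for k n
  have good: "good k n (G k n)" if "k > 0" "n \<ge> N k" "3 * k dvd n" for k n
  proof -
    have n: "n \<ge> 1" using that N1[of k] by linarith
    define d where "d = c / 4 * real n powr (1 - 1 / real t)"
    have "d > 0" using assms n by (simp add: d_def)
    have "real n * real n powr (1 - 1 / real t) = real n powr (1 + (1 - 1 / real t))"
      unfolding powr_add using n by simp
    then have "4 * d * real n = c * real n powr (2 - 1 / real t)"
      by (simp add: d_def mult_ac)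
    also have "\<dots> \<le> real (zarankiewicz n t)" using assms(4) n by blast
    finally have z: "4 * d * real n \<le> real (zarankiewicz n t)" .
    have "real (s n - 1) < d" using \<open>d > 0\<close> unfolding s_def d_def[symmetric] by linarith
    then have "2 * real n * real (s n - 1) < 2 * real n * d" using n by simp
    also have "\<dots> \<le> 4 * d * real n" using \<open>d > 0\<close> by simp
    also note z
    finally have "2 * n * (s n - 1) < zarankiewicz n t"
      by (metis of_nat_less_iff of_nat_mult of_nat_numeral)
    moreover have "real (2 * s n) \<le> real (w k n)"
      unfolding w_eq[OF that(3)] using N[OF that(2,1)] by simp
    then have "2 * s n \<le> w k n" by (simp only: of_nat_le_iff)
    moreover have "3 * w k n \<le> n"
    proof -
      have "w k n * (3 * k) \<le> n" by (simp add: w_def)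
      moreover have "w k n * 3 \<le> w k n * (3 * k)" using that(1) by simp
      ultimately show ?thesis by linarith
    qed
    ultimately have "\<exists>G. good k n G"
      unfolding good_def using exists_tripartite_graph[OF assms(1)] by blast
    then show ?thesis unfolding G_def by (rule someI_ex)
  qed
  show ?thesis
  proof (intro exI[of _ G] exI[of _ N] conjI allI impI)
    fix k n assume A: "real k \<ge> 2 * C / (3 * c) \<and> n \<ge> N k \<and> 3 * k dvd n"
    then have g: "good k n (G k n)" using good k_pos by blast
    show "balanced_multipartite 3 n (G k n)" "\<not> embeds (complete_multipartite 3 t) (G k n)"
      using g by (auto simp: good_def)
    have "n > 0" using A N1[of k] by linarith
    then have "min_degree (G k n) \<ge> n + s n"
      using min_degree_geI[of 3 n "G k n" "n + s n"] g unfolding good_def by simp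
    moreover have "real (s n) \<ge> c / 4 * real n powr (1 - 1 / real t)"
      unfolding s_def by linarith
    ultimately show "real (min_degree (G k n)) \<ge> real n + c / 4 * real n powr (1 - 1 / real t)"
      by linarith
  next
    fix k k' assume A: "real k \<ge> 2 * C / (3 * c) \<and> real k' \<ge> 2 * C / (3 * c) \<and> k \<noteq> k'"
    then have k: "k > 0" "k' > 0" using k_pos by auto
    define \<eta> where "\<eta> = \<bar>1 / (3 * real k) - 1 / (3 * real k')\<bar>"
    have \<eta>: "\<eta> > 0" using A k by (simp add: \<eta>_def)
    \<comment> \<open>The widths differ by \<open>\<eta> n\<close>. Beyond \<open>M\<close> both factors of the profile gap keep at least half of
      their main terms \<open>n\<close> and \<open>\<eta> n\<close>, whence \<open>2 |F| \<ge> (n / 2) (\<eta> n / 2)\<close>.\<close>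
    obtain M where M: "\<forall>n\<ge>M. real (s n) \<le> min (\<eta> / 2) (1 / 6) * real n"
      using small[of "min (\<eta> / 2) (1 / 6)"] \<eta> by auto
    show "\<exists>\<epsilon>>0. \<exists>M. \<forall>n. n \<ge> M \<and> n \<ge> N k \<and> n \<ge> N k' \<and> 3 * k dvd n \<and> 3 * k' dvd n \<longrightarrow>
          (\<forall>F. F \<subseteq> edges (G k n) \<and> embeds (delete_edges (G k n) F) (G k' n) \<longrightarrow>
             real (card F) \<ge> \<epsilon> * (real n)\<^sup>2)"
    proof (intro exI[of _ "\<eta> / 8"] conjI exI[of _ M] allI impI)
      show "\<eta> / 8 > 0" using \<eta> by simp
      fix n F
      assume n: "n \<ge> M \<and> n \<ge> N k \<and> n \<ge> N k' \<and> 3 * k dvd n \<and> 3 * k' dvd n"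
        and F: "F \<subseteq> edges (G k n) \<and> embeds (delete_edges (G k n) F) (G k' n)"
      have g: "good k n (G k n)" "good k' n (G k' n)" using good k n by auto
      define D where "D = (w k n - w k' n) + (w k' n - w k n)"
      have gap: "(n - 3 * s n) * (D - s n) \<le> 2 * card F"
        unfolding D_def using g F
        by (intro deletions_ge_profile_gap[of "G k n" "G k' n"])
          (auto simp: good_def balanced_multipartite_def w_def)
      have "real D = \<bar>real (w k n) - real (w k' n)\<bar>" by (auto simp: D_def)
      also have "\<dots> = \<bar>(1 / (3 * real k) - 1 / (3 * real k')) * real n\<bar>"
        using n by (simp add: w_eq algebra_simps)
      also have "\<dots> = \<eta> * real n" by (simp add: \<eta>_def abs_mult)
      finally have D: "real D = \<eta> * real n" .
      have s: "real (s n) \<le> \<eta> / 2 * real n" "real (s n) \<le> 1 / 6 * real n"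
        using M n mult_right_mono[of "min (\<eta> / 2) (1 / 6)" _ "real n"]
        by (meson min.cobounded1 min.cobounded2 of_nat_0_le_iff order_trans)+
      have "\<eta> / 4 * (real n)\<^sup>2 = (1 / 2 * real n) * (\<eta> / 2 * real n)"
        by (simp add: power2_eq_square)
      also have "\<dots> \<le> real (n - 3 * s n) * real (D - s n)"
      proof (rule mult_mono)
        show "1 / 2 * real n \<le> real (n - 3 * s n)" using s by linarith
        show "\<eta> / 2 * real n \<le> real (D - s n)" using s D by linarith
      qed (use \<eta> in simp_all)
      also have "\<dots> \<le> real (2 * card F)" using gap by (metis of_nat_le_iff of_nat_mult)
      finally show "real (card F) \<ge> \<eta> / 8 * (real n)\<^sup>2" by simp
    qed
  qed
qed

end
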